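(* Let $E,F$ be Banach spaces, $U\subset E$ an open set, $f:U\to F$ a $C^1$ map, and $x_0\in U$ a point such that the Fréchet derivative $f'(x_0)\in B(E,F)$ is double splitting. Then $f$ is locally conjugate to $f'(x_0)$ near $x_0$ if and only if $x_0$ is a locally fine point of the operator-valued map $x\mapsto f'(x)$, $U\to B(E,F)$.
   Context: $B(E,F)$ is the space of bounded linear operators from $E$ to $F$; $N(\cdot)$ and $R(\cdot)$ denote null space and range; $I_E$, $I_F$ are the identity operators. An operator $A\in B(E,F)$ is double splitting if $R(A)$ is closed and there are closed subspaces $R^+\subset E$, $N^+\subset F$ with $E=N(A)\oplus R^+$ and $F=R(A)\oplus N^+$. A generalized inverse of $A$ is an operator $A^+\in B(F,E)$ with $A^+AA^+=A^+$ and $AA^+A=A$; it exists if and only if $A$ is double splitting. Locally fine point: let $X$ be a topological space and $x\mapsto T_x$ a map $X\to B(E,F)$ that is continuous at $x_0\in X$, with $T_0:=T_{x_0}$ double splitting. Then $x_0$ is a locally fine point of $T_x$ if there exist a generalized inverse $T_0^+$ of $T_0$ and a neighborhood $U_0$ of $x_0$ such that $R(T_x)\cap N(T_0^+)=\{0\}$ for all $x\in U_0$. Local conjugacy: $f$ is locally conjugate to $f'(x_0)$ near $x_0$ if there exist a neighborhood $U_0\subset U$ of $x_0$, a neighborhood $V_0\subset F$ of $0$, and ($C^1$) diffeomorphisms $\varphi:U_0\to\varphi(U_0)\subset E$ with $\varphi(x_0)=0$, $\varphi'(x_0)=I_E$, and $\psi:V_0\to\psi(V_0)\subset F$ with $\psi(0)=f(x_0)$,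 $\psi'(0)=I_F$, such that $f(x)=(\psi\circ f'(x_0)\circ\varphi)(x)$ for all $x\in U_0$ (in particular the composition is defined on $U_0$). *)

theory Defs
  imports "HOL-Analysis.Analysis"
begin

definition closed_subspace :: "'a::real_normed_vector set \<Rightarrow> bool" where
  "closed_subspace S \<longleftrightarrow> subspace S \<and> closed S"

definition null_space :: "('a::real_normed_vector \<Rightarrow>\<^sub>L 'b::real_normed_vector) \<Rightarrow> 'a set" where
  "null_space A = {x. blinfun_apply A x = 0}"

definition range_space :: "('a::real_normed_vector \<Rightarrow>\<^sub>L 'b::real_normed_vector) \<Rightarrow> 'b set" where
  "range_space A = range (blinfun_apply A)"

text \<open>The ambient space is the internal direct sum of the linear subspaces S and T.\<close>

definition is_direct_sum :: "'a::real_vector set \<Rightarrow> 'a set \<Rightarrow> bool" where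
  "is_direct_sum S T \<longleftrightarrow> {s + t |s t. s \<in> S \<and> t \<in> T} = UNIV \<and> S \<inter> T = {0}"

definition double_splitting :: "('a::real_normed_vector \<Rightarrow>\<^sub>L 'b::real_normed_vector) \<Rightarrow> bool" where
  "double_splitting A \<longleftrightarrow>
     closed (range_space A) \<and>
     (\<exists>R. closed_subspace R \<and> is_direct_sum (null_space A) R) \<and>
     (\<exists>N. closed_subspace N \<and> is_direct_sum (range_space A) N)"

definition generalized_inverse ::
  "('a::real_normed_vector \<Rightarrow>\<^sub>L 'b::real_normed_vector) \<Rightarrow> ('b \<Rightarrow>\<^sub>L 'a) \<Rightarrow> bool" where
  "generalized_inverse A B \<longleftrightarrow> B o\<^sub>L A o\<^sub>L B = B \<and> A o\<^sub>L B o\<^sub>L A = A"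

text \<open>The first two conjuncts are the standing assumptions under which the notion is defined;
  \<open>'a \<Rightarrow>\<^sub>L 'b\<close> carries the operator-norm topology.\<close>

definition locally_fine_point ::
  "'x topology \<Rightarrow> ('x \<Rightarrow> 'a::real_normed_vector \<Rightarrow>\<^sub>L 'b::real_normed_vector) \<Rightarrow> 'x \<Rightarrow> bool" where
  "locally_fine_point X T x0 \<longleftrightarrow>
     topcontinuous_at X euclidean T x0 \<and>
     double_splitting (T x0) \<and>
     (\<exists>B U0. generalized_inverse (T x0) B \<and> openin X U0 \<and> x0 \<in> U0 \<and>
        (\<forall>x\<in>U0. range_space (T x) \<inter> null_space B = {0}))"

text \<open>\<open>f\<close> is a \<open>C\<^sup>1\<close> map on the open set \<open>U\<close> with Frechet derivative \<open>f'\<close>, continuous in operator norm;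
  \<open>f\<close> and \<open>f'\<close> are irrelevant outside \<open>U\<close>.\<close>

definition C1_map_on ::
  "'a::real_normed_vector set \<Rightarrow> ('a \<Rightarrow> 'b::real_normed_vector) \<Rightarrow> ('a \<Rightarrow> 'a \<Rightarrow>\<^sub>L 'b) \<Rightarrow> bool" where
  "C1_map_on U f f' \<longleftrightarrow>
     open U \<and> (\<forall>x\<in>U. (f has_derivative blinfun_apply (f' x)) (at x)) \<and> continuous_on U f'"

definition C1_diffeomorphism_on ::
  "'a::real_normed_vector set \<Rightarrow> ('a \<Rightarrow> 'b::real_normed_vector) \<Rightarrow> bool" where
  "C1_diffeomorphism_on S g \<longleftrightarrow>
     open S \<and> open (g ` S) \<and> inj_on g S \<and>
     (\<exists>g'. C1_map_on S g g') \<and> (\<exists>h'. C1_map_on (g ` S) (inv_into S g) h')"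

text \<open>\<open>f\<close>, defined on \<open>U\<close>, is locally conjugate near \<open>x0\<close> to the bounded operator \<open>L\<close>.
  The domains \<open>U0\<close> and \<open>V0\<close> are open, being domains of \<open>C\<^sup>1\<close> diffeomorphisms.\<close>

definition locally_conjugate ::
  "'a::real_normed_vector set \<Rightarrow> ('a \<Rightarrow> 'b::real_normed_vector) \<Rightarrow> ('a \<Rightarrow>\<^sub>L 'b) \<Rightarrow> 'a \<Rightarrow> bool" where
  "locally_conjugate U f L x0 \<longleftrightarrow>
     (\<exists>U0 V0 \<phi> \<psi>.
        x0 \<in> U0 \<and> U0 \<subseteq> U \<and> 0 \<in> V0 \<and>
        C1_diffeomorphism_on U0 \<phi> \<and> \<phi> x0 = 0 \<and> (\<phi> has_derivative id) (at x0) \<and>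
        C1_diffeomorphism_on V0 \<psi> \<and> \<psi> 0 = f x0 \<and> (\<psi> has_derivative id) (at 0) \<and>
        (\<forall>x\<in>U0. blinfun_apply L (\<phi> x) \<in> V0 \<and> f x = (\<psi> \<circ> blinfun_apply L \<circ> \<phi>) x))"

end

theory Submission
  imports Defs
begin

text \<open>
  Write \<open>A = f' x0\<close> and let \<open>B\<close> be a generalized inverse of \<open>A\<close>.
  If \<open>f = \<psi> \<circ> A \<circ> \<phi>\<close> and \<open>P = \<psi>' (A (\<phi> x))\<close>, then every vector of the range of \<open>f' x\<close> has the
  form \<open>P w\<close> with \<open>w = A B w\<close>; when \<open>B P w = 0\<close>, we get \<open>w = A B (w - P w)\<close>, which forces \<open>w = 0\<close>
  as soon as \<open>P\<close> is close to the identity. Conversely, at a locally fine point put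
  \<open>\<phi> x = B (f x - f x0) + (I - B A) (x - x0)\<close> and \<open>g = f \<circ> \<phi>\<^sup>-\<^sup>1\<close>. Since \<open>A \<circ> \<phi>' x = A B f' x\<close>,
  fineness makes \<open>g'\<close> vanish on the null space of \<open>A\<close>, so \<open>g y = g (B A y)\<close> and
  \<open>\<psi> z = g (B z) + (I - A B) z\<close> satisfies \<open>g = \<psi> \<circ> A\<close>. Both \<open>\<phi>\<close> and \<open>\<psi>\<close> have the identity as
  derivative at the base point, so the inverse function theorem applies to them.
\<close>

section \<open>Open mapping theorem and existence of generalized inverses\<close>

text \<open>Completeness of the target gives, by Baire, approximate preimages of controlled norm;
  completeness of \<open>S\<close> turns them into exact ones by successive correction.\<close>

lemma open_mapping_subspace:
  fixes T :: "'a::banach \<Rightarrow> 'b::banach"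
  assumes T: "bounded_linear T" and S: "closed_subspace S" and surj: "T ` S = UNIV"
  obtains C where "\<And>y. \<exists>s\<in>S. T s = y \<and> norm s \<le> C * norm y"
proof -
  interpret T: bounded_linear T by fact
  have sub: "subspace S" and "closed S"
    using S by (auto simp: closed_subspace_def)
  define D where "D n = closure (T ` (S \<inter> cball 0 (real n)))" for n
  have "(\<Union>n. D n) = UNIV"
  proof -
    have "y \<in> (\<Union>n. D n)" for y
    proof -
      obtain s where "s \<in> S" "T s = y"
        using surj by (metis UNIV_I imageE)
      moreover obtain n :: nat where "norm s \<le> real n"
        using real_arch_simple by blast
      ultimately show ?thesis
        unfolding D_def using closure_subset by fastforce
    qed
    then show ?thesis by blast
  qed
  moreover have "interior (\<Union>n. D n) = {}" if "\<forall>n. interior (D n) = {}"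
  proof -
    have "completely_metrizable_space (euclidean :: 'b topology)"
      using completely_metrizable_space_euclidean by blast
    then have "euclidean interior_of \<Union>(range D) = {}"
      using that by (intro Baire_category_alt) (auto simp: D_def)
    then show ?thesis by simp
  qed
  ultimately obtain n where "interior (D n) \<noteq> {}"
    by fastforce
  then obtain y0 r where "r > 0" and r: "ball y0 r \<subseteq> D n"
    by (meson equals0I mem_interior)
  \<comment> \<open>Below, \<open>y\<close> is shrunk by the factor
    \<open>c = 2 * norm y / r\<close>, and two vectors of norm at most \<open>n\<close> are
    subtracted: \<open>c * (2 * n) = K * norm y\<close>.\<close>
  define K where "K = 4 * real n / r"
  have approx: "\<exists>s. s \<in> S \<and> norm s \<le> K * norm y \<and> norm (y - T s) \<le> norm y / 2" for y
  proof (cases "y = 0")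
    case True
    then show ?thesis
      using sub by (auto intro!: exI[of _ 0] simp: subspace_0 T.zero)
  next
    case False
    define c where "c = 2 * norm y / r"
    have "c > 0" using False \<open>r > 0\<close> by (simp add: c_def)
    \<comment> \<open>Two approximation errors of size \<open>e\<close>, scaled back by
      \<open>c\<close>, add up to \<open>norm y / 2\<close>.\<close>
    define e where "e = norm y / (4 * c)"
    have "e > 0" using False \<open>c > 0\<close> by (simp add: e_def)
    have "norm (y /\<^sub>R c) = r / 2"
      using False \<open>r > 0\<close> by (simp add: c_def)
    \<comment> \<open>Only a ball around some centre \<open>y0\<close> is known to lie in
      \<open>D n\<close>. Near-preimages of \<open>y0 + y /\<^sub>R c\<close> and of
      \<open>y0\<close> are subtracted, so the centre cancels.\<close>
    then have "y0 + y /\<^sub>R c \<in> D n" "y0 \<in> D n"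
      using r \<open>r > 0\<close> by (auto simp: subset_iff dist_norm)
    then obtain s1 s2 where s: "s1 \<in> S" "norm s1 \<le> n" "dist (T s1) (y0 + y /\<^sub>R c) < e"
        "s2 \<in> S" "norm s2 \<le> n" "dist (T s2) y0 < e"
      using \<open>e > 0\<close> unfolding D_def closure_approachable by fastforce
    have "c *\<^sub>R (s1 - s2) \<in> S"
      using s sub by (simp add: subspace_scale subspace_diff)
    moreover have "norm (c *\<^sub>R (s1 - s2)) \<le> K * norm y"
    proof -
      have "norm (s1 - s2) \<le> 2 * real n"
        using norm_triangle_ineq4[of s1 s2] s by linarith
      then have "c * norm (s1 - s2) \<le> c * (2 * real n)"
        using \<open>c > 0\<close> by simp
      also have "\<dots> = K * norm y" by (simp add: c_def K_def)
      finally show ?thesis using \<open>c > 0\<close> by simp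
    qed
    moreover have "norm (y - T (c *\<^sub>R (s1 - s2))) \<le> norm y / 2"
    proof -
      have "y - T (c *\<^sub>R (s1 - s2)) = c *\<^sub>R ((T s2 - y0) - (T s1 - (y0 + y /\<^sub>R c)))"
        using \<open>c > 0\<close> by (simp add: T.scaleR T.diff algebra_simps)
      moreover have "norm ((T s2 - y0) - (T s1 - (y0 + y /\<^sub>R c))) \<le> 2 * e"
        using norm_triangle_ineq4[of "T s2 - y0" "T s1 - (y0 + y /\<^sub>R c)"] s
        unfolding dist_norm by linarith
      ultimately have "norm (y - T (c *\<^sub>R (s1 - s2))) \<le> c * (2 * e)"
        using \<open>c > 0\<close> by simp
      also have "\<dots> = norm y / 2"
        using \<open>c > 0\<close> by (simp add: e_def)
      finally show ?thesis .
    qed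
    ultimately show ?thesis by blast
  qed
  then obtain \<sigma> where \<sigma>: "\<And>y. \<sigma> y \<in> S" "\<And>y. norm (\<sigma> y) \<le> K * norm y"
      "\<And>y. norm (y - T (\<sigma> y)) \<le> norm y / 2"
    by metis
  have "K \<ge> 0" using \<open>r > 0\<close> by (simp add: K_def)
  show thesis
  proof
    fix y
    \<comment> \<open>\<open>\<rho> k\<close> is the residual after \<open>k\<close> corrections. It
      at least halves each time, the sum of the corrections telescopes under \<open>T\<close>, and
      the geometric series turns the bound \<open>K\<close> into \<open>2 * K\<close>.\<close>
    define \<rho> where "\<rho> k = ((\<lambda>z. z - T (\<sigma> z)) ^^ k) y" for k
    have \<rho>: "norm (\<rho> k) \<le> norm y * (1/2) ^ k" for k
    proof (induction k)
      case (Suc k)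
      have "norm (\<rho> (Suc k)) \<le> norm (\<rho> k) / 2"
        using \<sigma>(3) by (simp add: \<rho>_def)
      with Suc show ?case by simp
    qed (simp add: \<rho>_def)
    have bound: "norm (\<sigma> (\<rho> k)) \<le> K * norm y * (1/2) ^ k" for k
      using order_trans[OF \<sigma>(2) mult_left_mono[OF \<rho> \<open>K \<ge> 0\<close>]] by (simp add: mult.assoc)
    have geo: "(\<lambda>k. K * norm y * (1/2) ^ k) sums (K * norm y * 2)"
      using sums_mult[OF geometric_sums[of "1/2::real"], of "K * norm y"] by simp
    have summ: "summable (\<lambda>k. norm (\<sigma> (\<rho> k)))"
      by (rule summable_comparison_test'[OF sums_summable[OF geo]]) (simp add: bound)
    define s where "s = (\<Sum>k. \<sigma> (\<rho> k))"
    have lim: "(\<lambda>n. \<Sum>k<n. \<sigma> (\<rho> k)) \<longlonglongrightarrow> s"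
      unfolding s_def using summable_norm_cancel[OF summ] by (rule summable_LIMSEQ)
    have "s \<in> S"
      using \<open>closed S\<close> _ lim
      by (rule closed_sequentially) (simp add: \<sigma> sub subspace_sum)
    moreover have "T s = y"
    proof -
      have part: "T (\<Sum>k<n. \<sigma> (\<rho> k)) = y - \<rho> n" for n
        by (induction n) (simp_all add: \<rho>_def T.add)
      have "\<rho> \<longlonglongrightarrow> 0"
      proof (rule Lim_null_comparison)
        show "(\<lambda>k. norm y * (1/2) ^ k) \<longlonglongrightarrow> 0"
          by (intro tendsto_mult_right_zero LIMSEQ_power_zero) simp
      qed (simp add: \<rho>)
      then have "(\<lambda>n. y - \<rho> n) \<longlonglongrightarrow> y - 0"
        by (intro tendsto_intros)
      then show ?thesis
        using T.tendsto[OF lim] LIMSEQ_unique by (fastforce simp: part)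
    qed
    moreover have "norm s \<le> (2 * K) * norm y"
    proof -
      have "norm s \<le> (\<Sum>k. norm (\<sigma> (\<rho> k)))"
        unfolding s_def using summ by (rule summable_norm)
      also have "\<dots> \<le> (\<Sum>k. K * norm y * (1/2) ^ k)"
        by (rule suminf_le[OF bound summ sums_summable[OF geo]])
      finally show ?thesis
        using sums_unique[OF geo] by simp
    qed
    ultimately show "\<exists>s\<in>S. T s = y \<and> norm s \<le> (2 * K) * norm y"
      by blast
  qed
qed

text \<open>Restricted to \<open>R\<close>, the operator \<open>A\<close> is injective and keeps its
  range. So \<open>B\<close> is built to invert this restriction on the range of \<open>A\<close>
  and to vanish on \<open>N\<close>; boundedness comes from the open mapping lemma.\<close>

lemma generalized_inverse_exists:
  fixes A :: "'a::banach \<Rightarrow>\<^sub>L 'b::banach"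
  assumes "double_splitting A"
  obtains B where "generalized_inverse A B"
proof -
  obtain R N where R: "closed_subspace R" "is_direct_sum (null_space A) R"
    and N: "closed_subspace N" "is_direct_sum (range_space A) N"
    using assms by (auto simp: double_splitting_def)
  \<comment> \<open>A bijection \<open>R \<times> N \<rightarrow> 'b\<close>; \<open>B\<close> is the first component of its bounded inverse.\<close>
  define T where "T = (\<lambda>p. A (fst p) + snd p)"
  have T: "bounded_linear T"
    unfolding T_def
    by (intro bounded_linear_add bounded_linear_compose[OF blinfun.bounded_linear_right]
        bounded_linear_fst bounded_linear_snd)
  interpret T: bounded_linear T by fact
  have S: "closed_subspace (R \<times> N)"
    using R(1) N(1) by (auto simp: closed_subspace_def closed_Times subspace_Times)
  then have sub: "subspace (R \<times> N)" by (simp add: closed_subspace_def)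
  have decomp: "\<exists>r\<in>R. A x = A r" for x
  proof -
    have "x \<in> {s + t |s t. s \<in> null_space A \<and> t \<in> R}"
      using R(2) by (simp add: is_direct_sum_def)
    then show ?thesis
      by (auto simp: null_space_def blinfun.add_right)
  qed
  have "T ` (R \<times> N) = UNIV"
  proof -
    have "y \<in> T ` (R \<times> N)" for y
    proof -
      have "y \<in> {s + t |s t. s \<in> range_space A \<and> t \<in> N}"
        using N(2) by (simp add: is_direct_sum_def)
      then obtain x n where "y = A x + n" "n \<in> N"
        by (auto simp: range_space_def)
      moreover obtain r where "r \<in> R" "A x = A r"
        using decomp by blast
      ultimately show ?thesis
        by (auto simp: T_def intro!: image_eqI[of _ _ "(r, n)"])
    qed
    then show ?thesis by blast
  qed
  then obtain C where C: "\<And>y. \<exists>s\<in>R \<times> N. T s = y \<and> norm s \<le> C * norm y"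
    using open_mapping_subspace[OF T S] by metis
  then obtain q where q: "\<And>y. q y \<in> R \<times> N" "\<And>y. T (q y) = y" "\<And>y. norm (q y) \<le> C * norm y"
    by metis
  have ker: "p = 0" if "p \<in> R \<times> N" "T p = 0" for p
  proof -
    obtain r n where p: "p = (r, n)" "r \<in> R" "n \<in> N" using \<open>p \<in> R \<times> N\<close> by auto
    have "n = A (- r)"
      using that(2) p by (simp add: T_def blinfun.minus_right eq_neg_iff_add_eq_0 add.commute)
    then have "n \<in> range_space A \<inter> N"
      using p by (simp add: range_space_def)
    then have "n = 0" using N(2) unfolding is_direct_sum_def by blast
    moreover from this have "r \<in> null_space A \<inter> R"
      using that(2) p by (simp add: T_def null_space_def)
    then have "r = 0" using R(2) unfolding is_direct_sum_def by blast
    ultimately show ?thesis using p by (simp add: zero_prod_def)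
  qed
  \<comment> \<open>\<open>q\<close> is a mere choice of preimages so far. Their uniqueness in
    \<open>R \<times> N\<close> makes it linear.\<close>
  have uniq: "q y = p" if "p \<in> R \<times> N" "T p = y" for p y
  proof -
    have "q y - p = 0"
      using that q sub by (intro ker subspace_diff) (auto simp: T.diff)
    then show ?thesis by simp
  qed
  have "bounded_linear q"
  proof (rule bounded_linear_intro[where K = C])
    show "q (x + y) = q x + q y" for x y
      by (rule uniq) (use q sub in \<open>auto simp: T.add intro!: subspace_add\<close>)
    show "q (c *\<^sub>R x) = c *\<^sub>R q x" for c x
      by (rule uniq) (use q sub in \<open>auto simp: T.scaleR intro!: subspace_scale\<close>)
    show "norm (q x) \<le> norm x * C" for x
      using q(3) by (simp add: mult.commute)
  qed
  then have bl: "bounded_linear (\<lambda>y. fst (q y))"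
    by (rule bounded_linear_fst_comp)
  define B where "B = Blinfun (\<lambda>y. fst (q y))"
  have B: "B y = fst (q y)" for y
    unfolding B_def by (simp add: bounded_linear_Blinfun_apply[OF bl])
  have qA: "q (A x) = (r, 0)" if "r \<in> R" "A x = A r" for x r
    using that N(1) by (intro uniq) (auto simp: T_def closed_subspace_def subspace_0)
  \<comment> \<open>Both defining equations of a generalized inverse reduce to this one, because
    \<open>B y\<close> lies in \<open>R\<close> and every \<open>A x\<close> equals
    \<open>A r\<close> for some \<open>r\<close> in \<open>R\<close>.\<close>
  have BA: "B (A r) = r" if "r \<in> R" for r
    using that by (simp add: B qA)
  have "B (A (B y)) = B y" for y
    using q(1)[of y] by (intro BA) (auto simp: B)
  moreover have "A (B (A x)) = A x" for x
    using decomp[of x] BA by auto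
  ultimately have "generalized_inverse A B"
    by (auto simp: generalized_inverse_def intro!: blinfun_eqI)
  then show thesis by (rule that)
qed

section \<open>Perturbations of the identity and the inverse function theorem\<close>

text \<open>Solutions are the fixed points of \<open>x + (y - f x)\<close>, which contracts by 1/2
  because \<open>f\<close> minus the identity does. The ball is mapped into itself: the defect at
  the centre and the contraction each use up at most \<open>\<rho> / 2\<close>.\<close>

lemma near_identity_solve:
  fixes f :: "'a::banach \<Rightarrow> 'a"
  assumes near: "\<And>x y. x \<in> D \<Longrightarrow> y \<in> D \<Longrightarrow> norm ((f x - f y) - (x - y)) \<le> norm (x - y) / 2"
    and sub: "cball a \<rho> \<subseteq> D" and "0 \<le> \<rho>" and y: "norm (y - f a) \<le> \<rho> / 2"
  obtains x where "x \<in> cball a \<rho>" "f x = y"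
proof -
  let ?u = "\<lambda>x. x + (y - f x)"
  have "\<exists>!x. x \<in> cball a \<rho> \<and> ?u x = x"
  proof (rule Banach_fix[where c = "1/2"])
    show "complete (cball a \<rho>)" by (simp add: complete_eq_closed)
    show "cball a \<rho> \<noteq> {}" using \<open>0 \<le> \<rho>\<close> by simp
    show "?u ` cball a \<rho> \<subseteq> cball a \<rho>"
    proof clarify
      fix x assume x: "x \<in> cball a \<rho>"
      have "norm ((f x - f a) - (x - a)) \<le> norm (x - a) / 2"
        using x \<open>0 \<le> \<rho>\<close> sub by (intro near) auto
      moreover have "norm (x - a) \<le> \<rho>"
        using x by (simp add: dist_norm norm_minus_commute)
      moreover have "norm (?u x - a) \<le> norm (y - f a) + norm ((f x - f a) - (x - a))"
        using norm_triangle_ineq4[of "y - f a" "(f x - f a) - (x - a)"]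
        by (simp add: algebra_simps)
      ultimately have "norm (?u x - a) \<le> \<rho>" using y by linarith
      then show "?u x \<in> cball a \<rho>" by (simp add: dist_norm norm_minus_commute)
    qed
    show "dist (?u x) (?u z) \<le> 1/2 * dist x z" if "x \<in> cball a \<rho>" "z \<in> cball a \<rho>" for x z
    proof -
      have "?u x - ?u z = - ((f x - f z) - (x - z))"
        by simp
      then have "dist (?u x) (?u z) = norm ((f x - f z) - (x - z))"
        unfolding dist_norm by (simp only: norm_minus_cancel)
      also have "\<dots> \<le> norm (x - z) / 2"
        using that sub by (intro near) auto
      finally show ?thesis by (simp add: dist_norm)
    qed
  qed auto
  then show thesis using that by auto
qed

lemma near_identity_expansive:
  fixes f :: "'a::real_normed_vector \<Rightarrow> 'a"
  assumes "norm ((f x - f y) - (x - y)) \<le> norm (x - y) / 2"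
  shows "norm (x - y) \<le> 2 * norm (f x - f y)"
  using norm_triangle_ineq4[of "f x - f y" "(f x - f y) - (x - y)"] assms by simp

text \<open>Takes the place of a Neumann series: surjectivity comes from the fixed point lemma on
  the whole space, injectivity from the expansion estimate, whose constant 2 also bounds the
  inverse.\<close>

lemma blinfun_near_identity_inverse:
  fixes P :: "'a::banach \<Rightarrow>\<^sub>L 'a"
  assumes "norm (P - id_blinfun) \<le> 1/2"
  obtains Q where "P o\<^sub>L Q = id_blinfun" "Q o\<^sub>L P = id_blinfun" "norm Q \<le> 2"
proof -
  have near: "norm ((P x - P y) - (x - y)) \<le> norm (x - y) / 2" for x y
  proof -
    have "(P x - P y) - (x - y) = (P - id_blinfun) (x - y)"
      by (simp add: blinfun.bilinear_simps)
    also have "norm \<dots> \<le> norm (P - id_blinfun) * norm (x - y)"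
      by (rule norm_blinfun)
    also have "\<dots> \<le> 1/2 * norm (x - y)"
      by (intro mult_right_mono assms) simp
    finally show ?thesis by simp
  qed
  \<comment> \<open>As \<open>P 0 = 0\<close>, the defect at the centre 0 is \<open>norm y\<close>,
    whence the radius \<open>2 * norm y\<close>.\<close>
  have "\<exists>x. P x = y" for y
    by (rule near_identity_solve[OF near subset_UNIV, where y = y and a = 0 and \<rho> = "2 * norm y"])
      (auto simp: blinfun.zero_right)
  then obtain q where q: "\<And>y. P (q y) = y" by metis
  have exp: "norm (x - y) \<le> 2 * norm (P x - P y)" for x y
    using near by (rule near_identity_expansive)
  have inj: "x = y" if "P x = P y" for x y
    using exp[of x y] that by simp
  have "bounded_linear q"
  proof (rule bounded_linear_intro[where K = 2])
    show "q (x + y) = q x + q y" for x y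
      by (rule inj) (simp add: q blinfun.add_right)
    show "q (c *\<^sub>R x) = c *\<^sub>R q x" for c x
      by (rule inj) (simp add: q blinfun.scaleR_right)
    show "norm (q x) \<le> norm x * 2" for x
      using exp[of "q x" 0] by (simp add: q blinfun.zero_right)
  qed
  then have Q: "blinfun_apply (Blinfun q) = q"
    by (rule bounded_linear_Blinfun_apply)
  show thesis
  proof
    show "P o\<^sub>L Blinfun q = id_blinfun"
      by (rule blinfun_eqI) (simp add: Q q)
    show "Blinfun q o\<^sub>L P = id_blinfun"
      by (rule blinfun_eqI) (auto simp: Q q intro: inj)
    show "norm (Blinfun q) \<le> 2"
      using exp[of "q _" 0] by (intro norm_blinfun_bound) (simp_all add: Q q blinfun.zero_right)
  qed
qed

text \<open>By continuity of \<open>f'\<close> and the mean value inequality, \<open>f\<close> minus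
  the identity is 1/2-Lipschitz on a small ball. The contraction argument makes images of open sets
  open; the expansion estimate makes \<open>f\<close> injective with continuous inverse. One radius
  serves all open \<open>W\<close>, since the domain of \<open>\<phi>\<close> is shrunk later by
  conditions that involve \<open>\<phi>\<close> itself.\<close>

lemma C1_diffeomorphism_near_identity:
  fixes f :: "'a::banach \<Rightarrow> 'a"
  assumes f: "C1_map_on U f f'" and "x0 \<in> U" and id: "f' x0 = id_blinfun"
  obtains r where "r > 0" "ball x0 r \<subseteq> U"
    "\<And>W. open W \<Longrightarrow> W \<subseteq> ball x0 r \<Longrightarrow> C1_diffeomorphism_on W f"
proof -
  have "open U" and der: "\<And>x. x \<in> U \<Longrightarrow> (f has_derivative f' x) (at x)" and cont: "continuous_on U f'"
    using f by (auto simp: C1_map_on_def)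
  obtain r1 where "r1 > 0" "ball x0 r1 \<subseteq> U"
    using \<open>open U\<close> \<open>x0 \<in> U\<close> open_contains_ball by blast
  moreover obtain r2 where "r2 > 0" and r2: "\<And>x. x \<in> U \<Longrightarrow> dist x x0 < r2 \<Longrightarrow> dist (f' x) (f' x0) < 1/2"
    using cont \<open>x0 \<in> U\<close> unfolding continuous_on_iff by (metis half_gt_zero_iff zero_less_one)
  moreover define r where "r = min r1 r2"
  ultimately have "r > 0" and rU: "ball x0 r \<subseteq> U"
    and close: "\<And>x. x \<in> ball x0 r \<Longrightarrow> norm (f' x - id_blinfun) \<le> 1/2"
    by (force simp: id dist_norm norm_minus_commute)+
  have near: "norm ((f x - f y) - (x - y)) \<le> norm (x - y) / 2"
    if "x \<in> ball x0 r" "y \<in> ball x0 r" for x y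
  proof -
    have "norm ((f x - x) - (f y - y)) \<le> 1/2 * norm (x - y)"
    proof (rule differentiable_bound[of "ball x0 r" "\<lambda>x. f x - x" "\<lambda>x. f' x - id_blinfun"])
      show "((\<lambda>x. f x - x) has_derivative (f' z - id_blinfun)) (at z within ball x0 r)"
        if "z \<in> ball x0 r" for z
        using has_derivative_at_withinI[OF der[of z]] that rU
        by (auto intro!: derivative_eq_intros simp: blinfun.diff_left)
      show "onorm (f' z - id_blinfun) \<le> 1/2" if "z \<in> ball x0 r" for z
        using close[OF that] by (simp add: norm_blinfun.rep_eq)
    qed (use that in auto)
    then show ?thesis by (simp add: algebra_simps)
  qed
  have exp: "norm (x - y) \<le> 2 * norm (f x - f y)" if "x \<in> ball x0 r" "y \<in> ball x0 r" for x y
    using near[OF that] by (rule near_identity_expansive)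
  have "\<exists>Q. f' x o\<^sub>L Q = id_blinfun \<and> Q o\<^sub>L f' x = id_blinfun \<and> norm Q \<le> 2"
    if "x \<in> ball x0 r" for x
    using blinfun_near_identity_inverse[OF close[OF that]] by metis
  then obtain Q where Q: "\<And>x. x \<in> ball x0 r \<Longrightarrow> f' x o\<^sub>L Q x = id_blinfun"
      "\<And>x. x \<in> ball x0 r \<Longrightarrow> Q x o\<^sub>L f' x = id_blinfun"
      "\<And>x. x \<in> ball x0 r \<Longrightarrow> norm (Q x) \<le> 2"
    by metis
  have Q_lip: "norm (Q x - Q y) \<le> 4 * norm (f' x - f' y)" if "x \<in> ball x0 r" "y \<in> ball x0 r" for x y
  proof -
    \<comment> \<open>The resolvent identity; with both inverses bounded by 2 it yields the factor
      4, and so continuity of the derivative of the inverse.\<close>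
    have "Q x - Q y = Q x o\<^sub>L (f' y - f' x) o\<^sub>L Q y"
    proof (rule blinfun_eqI)
      fix v
      have "f' y (Q y v) = v" "Q x (f' x (Q y v)) = Q y v"
        using Q(1)[OF that(2)] Q(2)[OF that(1)]
        by (metis blinfun_apply_blinfun_compose blinfun_apply_id_blinfun id_apply)+
      then show "(Q x - Q y) v = (Q x o\<^sub>L (f' y - f' x) o\<^sub>L Q y) v"
        by (simp add: blinfun.bilinear_simps)
    qed
    also have "norm \<dots> \<le> norm (Q x) * norm (f' y - f' x) * norm (Q y)"
      by (meson norm_blinfun_compose order_trans mult_right_mono norm_ge_zero)
    also have "\<dots> \<le> 2 * norm (f' y - f' x) * 2"
      using that Q(3) by (intro mult_mono) auto
    finally show ?thesis by (simp add: norm_minus_commute)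
  qed
  show thesis
  proof
    fix W assume "open W" and W: "W \<subseteq> ball x0 r"
    let ?g = "inv_into W f"
    have inj: "inj_on f W"
    proof (rule inj_onI)
      fix x y assume "x \<in> W" "y \<in> W" "f x = f y"
      then show "x = y" using exp[OF subsetD[OF W] subsetD[OF W], of x y] by simp
    qed
    have opn: "open (f ` W)"
      unfolding open_contains_ball
    proof clarify
      fix a assume "a \<in> W"
      then obtain \<rho> where "\<rho> > 0" and \<rho>: "cball a \<rho> \<subseteq> W"
        using \<open>open W\<close> open_contains_cball by blast
      \<comment> \<open>The radius \<open>\<rho> / 2\<close> is the largest defect that the fixed
        point lemma admits on \<open>cball a \<rho>\<close>.\<close>
      have "ball (f a) (\<rho> / 2) \<subseteq> f ` W"
      proof
        fix y assume "y \<in> ball (f a) (\<rho> / 2)"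
        then have "norm (y - f a) \<le> \<rho> / 2"
          by (simp add: dist_norm norm_minus_commute)
        moreover have "cball a \<rho> \<subseteq> ball x0 r" using \<rho> W by blast
        ultimately obtain x where "x \<in> cball a \<rho>" "f x = y"
          using near_identity_solve[of "ball x0 r" f a \<rho> y, OF near] \<open>\<rho> > 0\<close> by (metis less_imp_le)
        then show "y \<in> f ` W" using \<rho> by blast
      qed
      then show "\<exists>e>0. ball (f a) e \<subseteq> f ` W"
        using \<open>\<rho> > 0\<close> by (meson half_gt_zero)
    qed
    have gW: "?g y \<in> W" "f (?g y) = y" if "y \<in> f ` W" for y
      using that by (auto intro: inv_into_into f_inv_into_f)
    have cont_g: "continuous_on (f ` W) ?g"
    proof (rule continuous_on_eq_continuous_within[THEN iffD2], rule ballI)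
      fix y assume y: "y \<in> f ` W"
      show "continuous (at y within f ` W) ?g"
        unfolding continuous_within_eps_delta
      proof (intro allI impI)
        fix e :: real assume "e > 0"
        have "dist (?g z) (?g y) < e" if "z \<in> f ` W" "dist z y < e / 2" for z
        proof -
          have "norm (?g z - ?g y) \<le> 2 * norm (f (?g z) - f (?g y))"
            by (rule exp[OF subsetD[OF W] subsetD[OF W]]) (rule gW that y)+
          then show ?thesis using that y gW by (simp add: dist_norm)
        qed
        then show "\<exists>d>0. \<forall>z\<in>f ` W. dist z y < d \<longrightarrow> dist (?g z) (?g y) < e"
          using \<open>e > 0\<close> by (intro exI[of _ "e/2"]) auto
      qed
    qed
    have der_g: "(?g has_derivative Q (?g y)) (at y)" if y: "y \<in> f ` W" for y
    proof (rule has_derivative_inverse_basic[where f = f and f' = "f' (?g y)" and T = "f ` W"])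
      have g: "?g y \<in> ball x0 r" using gW[OF y] W by blast
      then show "(f has_derivative f' (?g y)) (at (?g y))" using rU der by blast
      show "blinfun_apply (Q (?g y)) \<circ> blinfun_apply (f' (?g y)) = id"
        by (simp add: fun_eq_iff Q(2)[OF g] flip: blinfun_apply_blinfun_compose)
      show "continuous (at y) ?g"
        using cont_g y by (auto simp: continuous_on_eq_continuous_at[OF opn])
    qed (use opn y gW blinfun.bounded_linear_right in auto)
    have "continuous_on (ball x0 r) Q"
      unfolding continuous_on_iff
    proof (intro ballI allI impI)
      fix x and e :: real assume x: "x \<in> ball x0 r" and "e > 0"
      then have "x \<in> U" "e / 4 > 0" using rU by auto
      then obtain d where "d > 0" and d: "\<And>z. z \<in> U \<Longrightarrow> dist z x < d \<Longrightarrow> dist (f' z) (f' x) < e / 4"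
        using cont unfolding continuous_on_iff by blast
      have "dist (Q z) (Q x) < e" if "z \<in> ball x0 r" "dist z x < d" for z
        using Q_lip[OF that(1) x] d[of z] that rU by (auto simp: dist_norm)
      then show "\<exists>d>0. \<forall>z\<in>ball x0 r. dist z x < d \<longrightarrow> dist (Q z) (Q x) < e"
        using \<open>d > 0\<close> by blast
    qed
    then have "continuous_on (f ` W) (\<lambda>y. Q (?g y))"
      using cont_g gW W by (auto intro: continuous_on_compose2)
    then have "C1_map_on (f ` W) ?g (\<lambda>y. Q (?g y))"
      using opn der_g by (simp add: C1_map_on_def)
    moreover have "C1_map_on W f f'"
      using \<open>open W\<close> W rU der cont
      by (auto simp: C1_map_on_def intro: continuous_on_subset)
    ultimately show "C1_diffeomorphism_on W f"
      using \<open>open W\<close> opn inj unfolding C1_diffeomorphism_on_def by blast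
  qed (use \<open>r > 0\<close> rU in auto)
qed

section \<open>Derivatives of C1 maps and of their inverses\<close>

lemma C1_map_on_derivative_id:
  assumes "C1_map_on U f f'" "x \<in> U" "(f has_derivative id) (at x)"
  shows "f' x = id_blinfun"
proof -
  have "blinfun_apply (f' x) = id"
    using assms has_derivative_unique unfolding C1_map_on_def by blast
  then show ?thesis by (intro blinfun_eqI) simp
qed

lemma C1_map_on_continuous_on: "C1_map_on U f f' \<Longrightarrow> continuous_on U f"
  unfolding C1_map_on_def
  by (meson continuous_at_imp_continuous_on has_derivative_continuous)

text \<open>A diffeomorphism supplies \<open>h'\<close> only by existence. The chain rule on
  \<open>f (inv_into S f z) = z\<close>, valid on the open image, ties \<open>h'\<close> to
  \<open>f'\<close>.\<close>

lemma C1_inverse_derivative: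
  assumes f: "C1_map_on S f f'" and h: "C1_map_on (f ` S) (inv_into S f) h'" and y: "y \<in> f ` S"
  shows "f' (inv_into S f y) (h' y v) = v"
proof -
  have "open (f ` S)" using h by (simp add: C1_map_on_def)
  have "(f has_derivative f' (inv_into S f y)) (at (inv_into S f y))"
    "(inv_into S f has_derivative h' y) (at y)"
    using f h y by (auto simp: C1_map_on_def inv_into_into)
  then have "((\<lambda>z. f (inv_into S f z)) has_derivative (\<lambda>v. f' (inv_into S f y) (h' y v))) (at y)"
    by (rule has_derivative_compose[rotated])
  moreover have "((\<lambda>z. f (inv_into S f z)) has_derivative (\<lambda>v. v)) (at y)"
    by (rule has_derivative_transform_within_open[OF has_derivative_ident \<open>open (f ` S)\<close> y])
      (simp add: f_inv_into_f)
  ultimately show ?thesis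
    using has_derivative_unique by metis
qed

section \<open>From local conjugacy to local fineness\<close>

lemma locally_conjugate_imp_locally_fine_point:
  fixes f :: "'a::banach \<Rightarrow> 'b::banach"
  assumes f: "C1_map_on U f f'" and "x0 \<in> U" and ds: "double_splitting (f' x0)"
    and conj: "locally_conjugate U f (f' x0) x0"
  shows "locally_fine_point (top_of_set U) f' x0"
proof -
  let ?A = "f' x0"
  have "open U" and der_f: "\<And>x. x \<in> U \<Longrightarrow> (f has_derivative f' x) (at x)" and "continuous_on U f'"
    using f by (auto simp: C1_map_on_def)
  obtain U0 V0 \<phi> \<psi> where "x0 \<in> U0" "U0 \<subseteq> U" "0 \<in> V0"
    and \<phi>: "C1_diffeomorphism_on U0 \<phi>" "\<phi> x0 = 0"
    and \<psi>: "C1_diffeomorphism_on V0 \<psi>" "(\<psi> has_derivative id) (at 0)"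
    and eq: "\<And>x. x \<in> U0 \<Longrightarrow> ?A (\<phi> x) \<in> V0 \<and> f x = \<psi> (?A (\<phi> x))"
    using conj unfolding locally_conjugate_def by auto
  obtain \<phi>' \<psi>' where \<phi>': "C1_map_on U0 \<phi> \<phi>'" and \<psi>': "C1_map_on V0 \<psi> \<psi>'"
    using \<phi> \<psi> unfolding C1_diffeomorphism_on_def by blast
  then have "open U0" by (simp add: C1_map_on_def)
  obtain B where B: "generalized_inverse ?A B"
    using generalized_inverse_exists[OF ds] .
  have ABA: "?A (B (?A x)) = ?A x" for x
    using B unfolding generalized_inverse_def by (metis blinfun_apply_blinfun_compose)
  let ?P = "\<lambda>x. \<psi>' (?A (\<phi> x))"
  \<comment> \<open>The vector \<open>w\<close> below satisfies
    \<open>norm w \<le> ?N x * norm w\<close>. The neighbourhood \<open>W\<close> is where this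
    factor is less than 1; it contains \<open>x0\<close> because \<open>?P x0\<close> is the
    identity.\<close>
  let ?N = "\<lambda>x. norm (?A o\<^sub>L B) * norm (?P x - id_blinfun)"
  have cont: "continuous_on U0 ?N"
  proof -
    have "continuous_on U0 (\<lambda>x. ?A (\<phi> x))"
      by (intro continuous_intros C1_map_on_continuous_on[OF \<phi>'])
    then have "continuous_on U0 ?P"
      using \<psi>' eq unfolding C1_map_on_def by (auto intro: continuous_on_compose2)
    then show ?thesis by (intro continuous_intros)
  qed
  define W where "W = U0 \<inter> ?N -` {..<1}"
  have "open W"
    unfolding W_def by (rule continuous_open_preimage[OF cont \<open>open U0\<close> open_lessThan])
  have "?P x0 = id_blinfun"
    using C1_map_on_derivative_id[OF \<psi>' \<open>0 \<in> V0\<close> \<psi>(2)] by (simp add: \<phi> blinfun.zero_right)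
  then have "x0 \<in> W" using \<open>x0 \<in> U0\<close> by (simp add: W_def)
  have "range_space (f' x) \<inter> null_space B = {0}" if "x \<in> W" for x
  proof -
    have x: "x \<in> U0" "?N x < 1" using that by (auto simp: W_def)
    have factor: "f' x k = ?P x (?A (\<phi>' x k))" for k
    proof -
      have "(\<phi> has_derivative \<phi>' x) (at x)" "(\<psi> has_derivative ?P x) (at (?A (\<phi> x)))"
        using \<phi>' \<psi>' x eq by (auto simp: C1_map_on_def)
      then have "((\<lambda>x. \<psi> (?A (\<phi> x))) has_derivative (\<lambda>k. ?P x (?A (\<phi>' x k)))) (at x)"
        by (intro has_derivative_compose[where f = "\<lambda>x. ?A (\<phi> x)" and g = \<psi>]
            bounded_linear.has_derivative[OF blinfun.bounded_linear_right])
      then have "(f has_derivative (\<lambda>k. ?P x (?A (\<phi>' x k)))) (at x)"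
        by (rule has_derivative_transform_within_open[OF _ \<open>open U0\<close> x(1)]) (simp add: eq)
      moreover have "(f has_derivative f' x) (at x)"
        using der_f x \<open>U0 \<subseteq> U\<close> by blast
      ultimately have "blinfun_apply (f' x) = (\<lambda>k. ?P x (?A (\<phi>' x k)))"
        using has_derivative_unique by blast
      then show ?thesis by (rule fun_cong)
    qed
    have "f' x k = 0" if k: "B (f' x k) = 0" for k
    proof -
      define w where "w = ?A (\<phi>' x k)"
      have w: "B (?P x w) = 0" "?A (B w) = w" using k ABA by (simp_all add: factor w_def)
      have "w = - (?A o\<^sub>L B) ((?P x - id_blinfun) w)"
        using w by (simp add: blinfun.bilinear_simps)
      then have "norm w \<le> norm (?A o\<^sub>L B) * norm ((?P x - id_blinfun) w)"
        by (metis norm_blinfun norm_minus_cancel blinfun.minus_left)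
      also have "\<dots> \<le> norm (?A o\<^sub>L B) * (norm (?P x - id_blinfun) * norm w)"
        by (intro mult_left_mono norm_blinfun) simp
      finally have "norm w \<le> ?N x * norm w" by (simp add: mult.assoc)
      then have "w = 0"
        using x(2) mult_less_cancel_right2[of "?N x" "norm w"] by (auto simp: not_le[symmetric])
      then show ?thesis by (simp add: factor w_def[symmetric] blinfun.zero_right)
    qed
    then show ?thesis
      by (auto simp: range_space_def null_space_def blinfun.zero_right intro: range_eqI[of _ _ 0])
  qed
  moreover have "openin (top_of_set U) W"
    using \<open>open W\<close> \<open>open U\<close> \<open>U0 \<subseteq> U\<close> by (auto simp: openin_open_eq W_def)
  moreover have "topcontinuous_at (top_of_set U) euclidean f' x0"
    using \<open>continuous_on U f'\<close> \<open>x0 \<in> U\<close> continuous_map_eq_topcontinuous_at[of "top_of_set U" euclidean f']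
    by simp
  ultimately show ?thesis
    using ds B \<open>x0 \<in> W\<close> unfolding locally_fine_point_def by blast
qed

section \<open>From local fineness to local conjugacy\<close>

lemma locally_fine_point_imp_locally_conjugate:
  fixes f :: "'a::banach \<Rightarrow> 'b::banach"
  assumes f: "C1_map_on U f f'" and "x0 \<in> U" and fine: "locally_fine_point (top_of_set U) f' x0"
  shows "locally_conjugate U f (f' x0) x0"
proof -
  let ?A = "f' x0"
  have "open U" and der_f: "\<And>x. x \<in> U \<Longrightarrow> (f has_derivative f' x) (at x)" and cont_f': "continuous_on U f'"
    using f by (auto simp: C1_map_on_def)
  obtain B U1 where B: "generalized_inverse ?A B" and "openin (top_of_set U) U1" and "x0 \<in> U1"
    and trivial: "\<And>x. x \<in> U1 \<Longrightarrow> range_space (f' x) \<inter> null_space B = {0}"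
    using fine by (auto simp: locally_fine_point_def)
  then have "open U1" "U1 \<subseteq> U"
    using \<open>open U\<close> by (auto simp: openin_open_eq)
  have ABA: "?A (B (?A x)) = ?A x" and BAB: "B (?A (B y)) = B y" for x y
    using B by (metis blinfun_apply_blinfun_compose generalized_inverse_def)+

  \<comment> \<open>\<open>B o\<^sub>L ?A\<close> projects onto the range of \<open>B\<close> along
    the null space of \<open>?A\<close>. The null space component of \<open>x - x0\<close> is kept,
    the other one is replaced by \<open>B (f x - f x0)\<close>.\<close>
  define \<phi> where "\<phi> x = B (f x - f x0) + ((x - x0) - B (?A (x - x0)))" for x
  define \<phi>' where "\<phi>' x = (B o\<^sub>L f' x) + (id_blinfun - (B o\<^sub>L ?A))" for x
  have \<phi>': "C1_map_on U1 \<phi> \<phi>'"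
    unfolding C1_map_on_def
  proof (intro conjI ballI)
    show "(\<phi> has_derivative \<phi>' x) (at x)" if "x \<in> U1" for x
      unfolding \<phi>_def using that \<open>U1 \<subseteq> U\<close>
      by (auto intro!: derivative_eq_intros der_f simp: \<phi>'_def blinfun.bilinear_simps)
    show "continuous_on U1 \<phi>'"
      unfolding \<phi>'_def
      by (intro continuous_intros continuous_on_subset[OF cont_f' \<open>U1 \<subseteq> U\<close>])
  qed fact
  have \<phi>'0: "\<phi>' x0 = id_blinfun" by (simp add: \<phi>'_def)
  obtain r where "r > 0" and r: "ball x0 r \<subseteq> U1"
    and diffeo_\<phi>: "\<And>W. open W \<Longrightarrow> W \<subseteq> ball x0 r \<Longrightarrow> C1_diffeomorphism_on W \<phi>"
    using C1_diffeomorphism_near_identity[OF \<phi>' \<open>x0 \<in> U1\<close> \<phi>'0] by blast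
  define W where "W = ball x0 r"
  have W: "open W" "x0 \<in> W" "W \<subseteq> U1" using r \<open>r > 0\<close> by (auto simp: W_def)
  have \<phi>_W: "C1_map_on W \<phi> \<phi>'"
    using \<phi>' W by (auto simp: C1_map_on_def intro: continuous_on_subset)
  define h where "h = inv_into W \<phi>"
  obtain h' where "inj_on \<phi> W" "open (\<phi> ` W)" and h': "C1_map_on (\<phi> ` W) h h'"
    using diffeo_\<phi>[of W] W by (auto simp: C1_diffeomorphism_on_def W_def h_def)
  have h_W: "h y \<in> W" if "y \<in> \<phi> ` W" for y
    using that by (simp add: h_def inv_into_into)
  have \<phi>'h': "\<phi>' (h y) (h' y v) = v" if "y \<in> \<phi> ` W" for y v
    unfolding h_def using C1_inverse_derivative[OF \<phi>_W h'[unfolded h_def] that] .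
  have \<phi>0: "\<phi> x0 = 0" by (simp add: \<phi>_def blinfun.zero_right)
  then have "0 \<in> \<phi> ` W" using W by force
  have h0: "h 0 = x0" using \<open>inj_on \<phi> W\<close> W \<phi>0 by (metis h_def inv_into_f_f)
  have h'0: "h' 0 v = v" for v
    using \<phi>'h'[OF \<open>0 \<in> \<phi> ` W\<close>, of v] by (simp add: h0 \<phi>'0)

  define g where "g y = f (h y)" for y
  define g' where "g' y = f' (h y) o\<^sub>L h' y" for y
  have g': "C1_map_on (\<phi> ` W) g g'"
    unfolding C1_map_on_def
  proof (intro conjI ballI)
    show "(g has_derivative g' y) (at y)" if "y \<in> \<phi> ` W" for y
    proof -
      have "(h has_derivative h' y) (at y)" using h' that unfolding C1_map_on_def by blast
      moreover have "(f has_derivative f' (h y)) (at (h y))"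
        using h_W[OF that] W \<open>U1 \<subseteq> U\<close> der_f by blast
      ultimately show ?thesis
        unfolding g_def g'_def blinfun_compose.rep_eq comp_def by (rule has_derivative_compose)
    qed
    have "continuous_on (\<phi> ` W) (\<lambda>y. f' (h y))"
      using h_W W \<open>U1 \<subseteq> U\<close>
      by (intro continuous_on_compose2[OF cont_f' C1_map_on_continuous_on[OF h']]) auto
    then show "continuous_on (\<phi> ` W) g'"
      using h' unfolding g'_def C1_map_on_def by (intro continuous_intros) auto
  qed fact

  have g'_null: "g' y v = 0" if "y \<in> \<phi> ` W" "?A v = 0" for y v
  proof -
    define k where "k = h' y v"
    let ?T = "f' (h y)"
    have "\<phi>' (h y) k = v" unfolding k_def using that by (simp add: \<phi>'h')
    then have v: "v = B (?T k) + (k - B (?A k))" by (simp add: \<phi>'_def blinfun.bilinear_simps)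
    \<comment> \<open>By \<open>ABA\<close> the summand \<open>k - B (?A k)\<close> is killed by
      \<open>?A\<close>. Then \<open>BAB\<close> turns \<open>?A (B (?T k)) = 0\<close> into
      \<open>B (?T k) = 0\<close>, and fineness applies at the point \<open>h y\<close>.\<close>
    have "?A (B (?T k)) = ?A v" unfolding v by (simp add: blinfun.bilinear_simps ABA)
    then have "B (?T k) = 0" using that BAB[of "?T k"] by (simp add: blinfun.zero_right)
    then have "?T k \<in> range_space ?T \<inter> null_space B"
      by (simp add: range_space_def null_space_def)
    then have "?T k = 0" using trivial[of "h y"] h_W[of y] that W by blast
    then show ?thesis by (simp add: g'_def k_def)
  qed
  \<comment> \<open>A ball is taken because it is convex: segments between its points stay where
    \<open>g\<close> is differentiable.\<close>
  obtain d where "d > 0" and d: "ball 0 d \<subseteq> \<phi> ` W"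
    using \<open>open (\<phi> ` W)\<close> \<open>0 \<in> \<phi> ` W\<close> open_contains_ball by blast
  \<comment> \<open>Along the segment, the derivative of \<open>g\<close> is evaluated in the
    direction \<open>y - z\<close>, which lies in the null space of \<open>?A\<close>.\<close>
  have g_const: "g y = g z" if "y \<in> ball 0 d" "z \<in> ball 0 d" "?A y = ?A z" for y z
  proof -
    have seg: "closed_segment z y \<subseteq> ball 0 d"
      using that by (simp add: closed_segment_subset)
    let ?G = "\<lambda>t::real. g (z + t *\<^sub>R (y - z))"
    have "(?G has_derivative (\<lambda>h. 0)) (at t within {0..1})" if t: "t \<in> {0..1}" for t
    proof -
      let ?p = "z + t *\<^sub>R (y - z)"
      have "?p \<in> closed_segment z y"
        using t by (auto simp: in_segment algebra_simps)
      then have p: "?p \<in> \<phi> ` W" using seg d by blast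
      have "((\<lambda>t. z + t *\<^sub>R (y - z)) has_derivative (\<lambda>h. h *\<^sub>R (y - z))) (at t within {0..1})"
        by (auto intro!: derivative_eq_intros)
      moreover have "(g has_derivative g' ?p) (at ?p)"
        using g' p unfolding C1_map_on_def by blast
      ultimately have "(?G has_derivative (\<lambda>h. g' ?p (h *\<^sub>R (y - z)))) (at t within {0..1})"
        by (rule has_derivative_compose)
      moreover have "g' ?p (h *\<^sub>R (y - z)) = 0" for h
        by (intro g'_null p) (simp add: blinfun.bilinear_simps \<open>?A y = ?A z\<close>)
      ultimately show ?thesis by simp
    qed
    then obtain c where "\<And>t. t \<in> {0..1} \<Longrightarrow> ?G t = c"
      using has_derivative_zero_constant[of "{0..1::real}" ?G] by auto
    from this[of 0] this[of 1] show ?thesis by simp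
  qed

  define D where "D = blinfun_apply B -` ball 0 d"
  have "open D"
    unfolding D_def by (intro open_vimage open_ball linear_continuous_on blinfun.bounded_linear_right)
  have "0 \<in> D" using \<open>d > 0\<close> by (simp add: D_def blinfun.zero_right)
  \<comment> \<open>\<open>?A o\<^sub>L B\<close> projects onto the range of \<open>?A\<close> along
    the null space of \<open>B\<close>. On that range the second summand vanishes and
    \<open>\<psi>\<close> is \<open>g\<close> after \<open>B\<close>; off it, this summand completes
    the derivative at 0 to the identity.\<close>
  define \<psi> where "\<psi> z = g (B z) + (z - ?A (B z))" for z
  define \<psi>' where "\<psi>' z = (g' (B z) o\<^sub>L B) + (id_blinfun - (?A o\<^sub>L B))" for z
  have \<psi>': "C1_map_on D \<psi> \<psi>'"
    unfolding C1_map_on_def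
  proof (intro conjI ballI)
    show "(\<psi> has_derivative \<psi>' z) (at z)" if "z \<in> D" for z
    proof -
      have "B z \<in> \<phi> ` W" using that d by (auto simp: D_def)
      then have "(g has_derivative g' (B z)) (at (B z))"
        using g' unfolding C1_map_on_def by blast
      then have "((\<lambda>z. g (B z)) has_derivative (\<lambda>v. g' (B z) (B v))) (at z)"
        by (rule has_derivative_compose[OF bounded_linear_imp_has_derivative[OF blinfun.bounded_linear_right]])
      then show ?thesis
        unfolding \<psi>_def
        by (auto intro!: derivative_eq_intros simp: \<psi>'_def blinfun.bilinear_simps)
    qed
    have "continuous_on D (\<lambda>z. g' (B z))"
      using g' d unfolding C1_map_on_def D_def
      by (intro continuous_on_compose2[of "\<phi> ` W" g' _ "blinfun_apply B"]) (auto intro: continuous_intros)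
    then show "continuous_on D \<psi>'"
      unfolding \<psi>'_def by (intro continuous_intros)
  qed fact
  have \<psi>'0: "\<psi>' 0 = id_blinfun"
    by (rule blinfun_eqI) (simp add: \<psi>'_def g'_def h0 h'0 blinfun.bilinear_simps)
  obtain \<rho> where "\<rho> > 0" and \<rho>: "ball 0 \<rho> \<subseteq> D"
    and diffeo_\<psi>: "\<And>V. open V \<Longrightarrow> V \<subseteq> ball 0 \<rho> \<Longrightarrow> C1_diffeomorphism_on V \<psi>"
    using C1_diffeomorphism_near_identity[OF \<psi>' \<open>0 \<in> D\<close> \<psi>'0] by blast

  \<comment> \<open>\<open>W\<close> lets \<open>h\<close> undo \<open>\<phi>\<close>,
    \<open>ball 0 d\<close> admits \<open>g_const\<close>, and \<open>ball 0 \<rho>\<close> is the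
    domain of \<open>\<psi>\<close>. Since \<open>ball 0 \<rho>\<close> lies in \<open>D\<close>,
    the point \<open>B (?A (\<phi> x))\<close> falls into \<open>ball 0 d\<close> as well.\<close>
  define U0 where "U0 = W \<inter> \<phi> -` (ball 0 d \<inter> blinfun_apply ?A -` ball 0 \<rho>)"
  have "open U0"
    unfolding U0_def
    by (intro continuous_open_preimage[OF C1_map_on_continuous_on[OF \<phi>_W]] W open_Int open_ball
        open_vimage continuous_intros)
  have "x0 \<in> U0"
    using W \<open>d > 0\<close> \<open>\<rho> > 0\<close> by (simp add: U0_def \<phi>0 blinfun.zero_right)
  have U0: "U0 \<subseteq> ball x0 r" "U0 \<subseteq> U"
    using W \<open>U1 \<subseteq> U\<close> by (auto simp: U0_def W_def)
  show ?thesis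
    unfolding locally_conjugate_def
  proof (intro exI conjI ballI)
    show "C1_diffeomorphism_on U0 \<phi>" using diffeo_\<phi> \<open>open U0\<close> U0 by blast
    show "C1_diffeomorphism_on (ball 0 \<rho>) \<psi>" using diffeo_\<psi> by blast
    show "(\<phi> has_derivative id) (at x0)"
      using \<phi>' \<open>x0 \<in> U1\<close> \<phi>'0 by (auto simp: C1_map_on_def id_def id_blinfun.rep_eq dest!: bspec)
    show "(\<psi> has_derivative id) (at 0)"
      using \<psi>' \<open>0 \<in> D\<close> \<psi>'0 by (auto simp: C1_map_on_def id_def id_blinfun.rep_eq dest!: bspec)
    show "\<psi> 0 = f x0" by (simp add: \<psi>_def g_def h0 blinfun.zero_right)
    fix x assume "x \<in> U0"
    then have x: "x \<in> W" "\<phi> x \<in> ball 0 d" "?A (\<phi> x) \<in> ball 0 \<rho>" by (auto simp: U0_def)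
    then show "?A (\<phi> x) \<in> ball 0 \<rho>" by simp
    have "B (?A (\<phi> x)) \<in> ball 0 d" using x \<rho> by (auto simp: D_def)
    \<comment> \<open>By \<open>ABA\<close> the two arguments of \<open>g\<close> have the same
      image under \<open>?A\<close>.\<close>
    then have "g (\<phi> x) = g (B (?A (\<phi> x)))"
      using x by (intro g_const) (simp_all add: ABA)
    moreover have "h (\<phi> x) = x" using \<open>inj_on \<phi> W\<close> x by (simp add: h_def)
    ultimately show "f x = (\<psi> \<circ> blinfun_apply ?A \<circ> \<phi>) x"
      by (simp add: \<psi>_def g_def ABA)
  qed (use \<open>x0 \<in> U0\<close> U0 \<open>\<rho> > 0\<close> \<phi>0 in auto)
qed

theorem theorem1p8:
  fixes U :: "'a::banach set"
    and f :: "'a \<Rightarrow> 'b::banach"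
    and f' :: "'a \<Rightarrow> 'a \<Rightarrow>\<^sub>L 'b"
    and x0 :: 'a
  assumes "open U"
    and "C1_map_on U f f'"
    and "x0 \<in> U"
    and "double_splitting (f' x0)"
  shows "locally_conjugate U f (f' x0) x0 \<longleftrightarrow> locally_fine_point (top_of_set U) f' x0"
proof
  assume "locally_conjugate U f (f' x0) x0"
  then show "locally_fine_point (top_of_set U) f' x0"
    using assms by (intro locally_conjugate_imp_locally_fine_point)
next
  assume "locally_fine_point (top_of_set U) f' x0"
  then show "locally_conjugate U f (f' x0) x0"
    using assms by (intro locally_fine_point_imp_locally_conjugate)
qed

end
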